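(* Let $\Gamma=\{r,b\}$ and let $R^{rb}\subset R^r,R^b\subset R$ be a compatible Frobenius square such that $R$ is generated as an algebra by its subalgebras $R^r$ and $R^b$. Then the composite of the sideways crossings $R\to R^r\otimes_{R^{rb}}R^b\to R$ equals, as an endomorphism of $R$ as an $(R^r,R^b)$-bimodule, multiplication by the element $\partial_r(\Delta^b_{rb(1)})\,\Delta^b_{rb(2)}\in R$. That is, for all $f\in R$, $$\partial_r\bigl(f\,\Delta^b_{rb(1)}\bigr)\,\Delta^b_{rb(2)}=f\cdot\partial_r\bigl(\Delta^b_{rb(1)}\bigr)\,\Delta^b_{rb(2)}.$$
   Context: All rings are commutative algebras over a field $\Bbbk$. A Frobenius extension is an extension $A\subset B$ with $B$ free and finitely generated as an $A$-module, together with an $A$-linear trace $\partial^B_A\colon B\to A$ for which there exist $A$-bases $\{x_\alpha\},\{y_\alpha\}$ of $B$ with $\partial^B_A(x_\alpha y_\beta)=\delta_{\alpha\beta}$ (dual bases). A compatible Frobenius square with $\Gamma=\{r,b\}$ consists of rings $R=R^\emptyset\supset R^r,R^b\supset R^{rb}$ with traces $\partial_r\colon R\to R^r$, $\partial_b\colon R\to R^b$, $\partial^r_{rb}\colon R^r\to R^{rb}$, $\partial^b_{rb}\colon R^b\to R^{rb}$ making each of the four inclusions a Frobenius extension, and with $\partial^r_{rb}\partial_r=\partial^b_{rb}\partial_b$. Sweedler notation: an expression containing $\Delta^b_{rb(1)}$ and $\Delta^b_{rb(2)}$ means the sum over $\alpha$ of the expression with $x_\alpha$ in place of $\Delta^b_{rb(1)}$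 and $y_\alpha$ in place of $\Delta^b_{rb(2)}$, where $\{x_\alpha\},\{y_\alpha\}$ are dual bases of $R^b$ over $R^{rb}$; it is independent of the choice. Elements of subrings are regarded as elements of $R$ via inclusion. The two sideways crossings are the $(R^r,R^b)$-bimodule maps $R\to R^r\otimes_{R^{rb}}R^b$, $f\mapsto \partial_r(f\Delta^b_{rb(1)})\otimes\Delta^b_{rb(2)}$, and $R^r\otimes_{R^{rb}}R^b\to R$, $x\otimes y\mapsto xy$. *)

theory Defs
  imports
    "HOL-Algebra.Module"
    "HOL-Algebra.Subrings"
    "HOL-Algebra.Generated_Groups"
    "HOL-Algebra.Free_Abelian_Groups"
    "HOL.Hull"
begin

section \<open>Subalgebras\<close>

text \<open>
  All rings are subalgebras of one commutative \<open>k\<close>-algebra \<open>R\<close>, given by their carrier sets, so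
  that the inclusions between them are literal inclusions of sets.
\<close>

definition ksubalgebra ::
  "('k, 'l) ring_scheme \<Rightarrow> ('k, 'a, 'm) module_scheme \<Rightarrow> 'a set \<Rightarrow> bool" where
  "ksubalgebra k R A \<longleftrightarrow>
     subring A R \<and> (\<forall>c\<in>carrier k. \<forall>a\<in>A. c \<odot>\<^bsub>R\<^esub> a \<in> A)"

definition algebra_generated ::
  "('k, 'l) ring_scheme \<Rightarrow> ('k, 'a, 'm) module_scheme \<Rightarrow> 'a set \<Rightarrow> 'a set" where
  "algebra_generated k R X = ksubalgebra k R hull X"


section \<open>Frobenius extensions\<close>

definition linear_over ::
  "('a, 'm) ring_scheme \<Rightarrow> 'a set \<Rightarrow> 'a set \<Rightarrow> ('a \<Rightarrow> 'a) \<Rightarrow> bool" where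
  "linear_over R A B \<phi> \<longleftrightarrow>
     (\<forall>b\<in>B. \<forall>b'\<in>B. \<phi> (b \<oplus>\<^bsub>R\<^esub> b') = \<phi> b \<oplus>\<^bsub>R\<^esub> \<phi> b') \<and>
     (\<forall>a\<in>A. \<forall>b\<in>B. \<phi> (a \<otimes>\<^bsub>R\<^esub> b) = a \<otimes>\<^bsub>R\<^esub> \<phi> b)"

text \<open>The finite family \<open>x 0, \<dots>, x (n - 1)\<close> is a basis of \<open>B\<close> as a module over \<open>A\<close>.\<close>

definition basis_over ::
  "('a, 'm) ring_scheme \<Rightarrow> 'a set \<Rightarrow> 'a set \<Rightarrow> nat \<Rightarrow> (nat \<Rightarrow> 'a) \<Rightarrow> bool" where
  "basis_over R A B n x \<longleftrightarrow>
     x \<in> {..<n} \<rightarrow> B \<and>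
     (\<forall>b\<in>B. \<exists>!a. a \<in> {..<n} \<rightarrow>\<^sub>E A \<and> b = (\<Oplus>\<^bsub>R\<^esub>\<alpha>\<in>{..<n}. a \<alpha> \<otimes>\<^bsub>R\<^esub> x \<alpha>))"

definition dual_bases ::
  "('a, 'm) ring_scheme \<Rightarrow> 'a set \<Rightarrow> 'a set \<Rightarrow> ('a \<Rightarrow> 'a) \<Rightarrow>
     nat \<Rightarrow> (nat \<Rightarrow> 'a) \<Rightarrow> (nat \<Rightarrow> 'a) \<Rightarrow> bool" where
  "dual_bases R A B tr n x y \<longleftrightarrow>
     basis_over R A B n x \<and> basis_over R A B n y \<and>
     (\<forall>\<alpha><n. \<forall>\<beta><n. tr (x \<alpha> \<otimes>\<^bsub>R\<^esub> y \<beta>) = (if \<alpha> = \<beta> then \<one>\<^bsub>R\<^esub> else \<zero>\<^bsub>R\<^esub>))"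

definition frobenius_extension ::
  "('k, 'l) ring_scheme \<Rightarrow> ('k, 'a, 'm) module_scheme \<Rightarrow>
     'a set \<Rightarrow> 'a set \<Rightarrow> ('a \<Rightarrow> 'a) \<Rightarrow> bool" where
  "frobenius_extension k R A B tr \<longleftrightarrow>
     ksubalgebra k R A \<and> ksubalgebra k R B \<and> A \<subseteq> B \<and>
     tr \<in> B \<rightarrow> A \<and> linear_over R A B tr \<and>
     (\<exists>n x y. dual_bases R A B tr n x y)"

locale compatible_frobenius_square =
  field k + algebra k R
  for k :: "('k, 'l) ring_scheme" and R :: "('k, 'a, 'm) module_scheme" +
  fixes Rr Rb Rrb :: "'a set"
    and tr_r tr_b tr_r_rb tr_b_rb :: "'a \<Rightarrow> 'a"
  assumes frob_r: "frobenius_extension k R Rr (carrier R) tr_r"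
    and frob_b: "frobenius_extension k R Rb (carrier R) tr_b"
    and frob_r_rb: "frobenius_extension k R Rrb Rr tr_r_rb"
    and frob_b_rb: "frobenius_extension k R Rrb Rb tr_b_rb"
    and compatible: "f \<in> carrier R \<Longrightarrow> tr_r_rb (tr_r f) = tr_b_rb (tr_b f)"


section \<open>Tensor products of submodules of a commutative ring\<close>

text \<open>
  For \<open>S\<close>-submodules \<open>M\<close> and \<open>N\<close> of \<open>R\<close>, the group \<open>tensor_product R S M N\<close> is the tensor product
  of \<open>M\<close> and \<open>N\<close> over \<open>S\<close>: the free Abelian group on \<open>M \<times> N\<close> modulo the bilinearity and balancing
  relations. It is written multiplicatively, as all quotient groups in HOL-Algebra are.
\<close>

definition tensor_relations ::
  "('a, 'm) ring_scheme \<Rightarrow> 'a set \<Rightarrow> 'a set \<Rightarrow> 'a set \<Rightarrow> ('a \<times> 'a \<Rightarrow>\<^sub>0 int) set" where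
  "tensor_relations R S M N =
     {frag_of (m \<oplus>\<^bsub>R\<^esub> m', n) - frag_of (m, n) - frag_of (m', n) | m m' n.
        m \<in> M \<and> m' \<in> M \<and> n \<in> N} \<union>
     {frag_of (m, n \<oplus>\<^bsub>R\<^esub> n') - frag_of (m, n) - frag_of (m, n') | m n n'.
        m \<in> M \<and> n \<in> N \<and> n' \<in> N} \<union>
     {frag_of (m \<otimes>\<^bsub>R\<^esub> s, n) - frag_of (m, s \<otimes>\<^bsub>R\<^esub> n) | m s n.
        m \<in> M \<and> s \<in> S \<and> n \<in> N}"

definition tensor_kernel ::
  "('a, 'm) ring_scheme \<Rightarrow> 'a set \<Rightarrow> 'a set \<Rightarrow> 'a set \<Rightarrow> ('a \<times> 'a \<Rightarrow>\<^sub>0 int) set" where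
  "tensor_kernel R S M N = generate (free_Abelian_group (M \<times> N)) (tensor_relations R S M N)"

definition tensor_product ::
  "('a, 'm) ring_scheme \<Rightarrow> 'a set \<Rightarrow> 'a set \<Rightarrow> 'a set \<Rightarrow> ('a \<times> 'a \<Rightarrow>\<^sub>0 int) set monoid" where
  "tensor_product R S M N = free_Abelian_group (M \<times> N) Mod tensor_kernel R S M N"

definition pure_tensor ::
  "('a, 'm) ring_scheme \<Rightarrow> 'a set \<Rightarrow> 'a set \<Rightarrow> 'a set \<Rightarrow> 'a \<Rightarrow> 'a \<Rightarrow> ('a \<times> 'a \<Rightarrow>\<^sub>0 int) set" where
  "pure_tensor R S M N m n =
     tensor_kernel R S M N #>\<^bsub>free_Abelian_group (M \<times> N)\<^esub> frag_of (m, n)"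


section \<open>The sideways crossings\<close>

text \<open>
  The families \<open>x\<close> and \<open>y\<close> are dual bases of \<open>Rb\<close> over \<open>Rrb\<close>; they play the roles of the two
  Sweedler components of the coproduct element.
\<close>

definition crossing_split ::
  "('a, 'm) ring_scheme \<Rightarrow> 'a set \<Rightarrow> 'a set \<Rightarrow> 'a set \<Rightarrow> ('a \<Rightarrow> 'a) \<Rightarrow>
     nat \<Rightarrow> (nat \<Rightarrow> 'a) \<Rightarrow> (nat \<Rightarrow> 'a) \<Rightarrow> 'a \<Rightarrow> ('a \<times> 'a \<Rightarrow>\<^sub>0 int) set" where
  "crossing_split R Rrb Rr Rb tr_r n x y f =
     (\<Otimes>\<^bsub>tensor_product R Rrb Rr Rb\<^esub>\<alpha>\<in>{..<n}.
        pure_tensor R Rrb Rr Rb (tr_r (f \<otimes>\<^bsub>R\<^esub> x \<alpha>)) (y \<alpha>))"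

definition crossing_merge ::
  "('a, 'm) ring_scheme \<Rightarrow> 'a set \<Rightarrow> 'a set \<Rightarrow> 'a set \<Rightarrow> ('a \<times> 'a \<Rightarrow>\<^sub>0 int) set \<Rightarrow> 'a" where
  "crossing_merge R Rrb Rr Rb =
     (THE h. h \<in> hom (tensor_product R Rrb Rr Rb) (add_monoid R) \<and>
        h \<in> extensional (carrier (tensor_product R Rrb Rr Rb)) \<and>
        (\<forall>p\<in>Rr. \<forall>q\<in>Rb. h (pure_tensor R Rrb Rr Rb p q) = p \<otimes>\<^bsub>R\<^esub> q))"

text \<open>The description in \<open>crossing_merge_def\<close> defines a map: the homomorphism exists and is unique.\<close>

lemma crossing_merge:
  assumes "cring R" and subs: "subring Rrb R" "subring Rr R" "subring Rb R"
    and "Rrb \<subseteq> Rr" "Rrb \<subseteq> Rb"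
  shows "crossing_merge R Rrb Rr Rb \<in> hom (tensor_product R Rrb Rr Rb) (add_monoid R)"
    and "\<And>p q. p \<in> Rr \<Longrightarrow> q \<in> Rb \<Longrightarrow>
           crossing_merge R Rrb Rr Rb (pure_tensor R Rrb Rr Rb p q) = p \<otimes>\<^bsub>R\<^esub> q"
proof -
  interpret cring R by fact
  define F where "F = free_Abelian_group (Rr \<times> Rb)"
  define K where "K = tensor_kernel R Rrb Rr Rb"
  let ?T = "tensor_product R Rrb Rr Rb"
  let ?P = "\<lambda>h. h \<in> hom ?T (add_monoid R) \<and> h \<in> extensional (carrier ?T) \<and>
        (\<forall>p\<in>Rr. \<forall>q\<in>Rb. h (pure_tensor R Rrb Rr Rb p q) = p \<otimes>\<^bsub>R\<^esub> q)"
  note S = subringE[OF subs(1)] and A = subringE[OF subs(2)] and B = subringE[OF subs(3)]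
  interpret F: comm_group F
    unfolding F_def by (rule abelian_free_Abelian_group)
  have F_simps: "carrier F = {c. Poly_Mapping.keys c \<subseteq> Rr \<times> Rb}"
    unfolding F_def by auto
  have rel_F: "tensor_relations R Rrb Rr Rb \<subseteq> carrier F"
  proof -
    have *: "Poly_Mapping.keys (a - b - c) \<subseteq> X"
      if "Poly_Mapping.keys a \<subseteq> X" "Poly_Mapping.keys b \<subseteq> X" "Poly_Mapping.keys c \<subseteq> X"
      for a b c :: "'a \<times> 'a \<Rightarrow>\<^sub>0 int" and X
      using that keys_diff[of "a - b" c] keys_diff[of a b] by blast
    have **: "Poly_Mapping.keys (a - b) \<subseteq> X"
      if "Poly_Mapping.keys a \<subseteq> X" "Poly_Mapping.keys b \<subseteq> X"
      for a b :: "'a \<times> 'a \<Rightarrow>\<^sub>0 int" and X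
      using that keys_diff[of a b] by blast
    have m: "p \<otimes>\<^bsub>R\<^esub> s \<in> Rr" "s \<otimes>\<^bsub>R\<^esub> q \<in> Rb" if "p \<in> Rr" "s \<in> Rrb" "q \<in> Rb" for p s q
      using that A(6) B(6) assms(5,6) by blast+
    show ?thesis
      unfolding tensor_relations_def F_simps
      by (rule subsetI, rule CollectI, elim UnE CollectE exE conjE; hypsubst;
          intro * **; simp add: A B m)
  qed
  have K: "subgroup K F"
    unfolding K_def tensor_kernel_def using rel_F F_def F.generate_is_subgroup by simp
  then have KN: "K \<lhd> F"
    by (rule F.subgroup_imp_normal)
  have T: "?T = F Mod K"
    by (simp add: tensor_product_def F_def K_def)
  have pt: "pure_tensor R Rrb Rr Rb p q = K #>\<^bsub>F\<^esub> frag_of (p, q)" for p q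
    by (simp add: pure_tensor_def F_def K_def)
  obtain h where h: "h \<in> hom F (add_monoid R)"
    and h_of: "\<And>z. z \<in> Rr \<times> Rb \<Longrightarrow> h (frag_of z) = (\<lambda>(p, q). p \<otimes>\<^bsub>R\<^esub> q) z"
  proof (rule comm_group.free_Abelian_group_universal
      [OF a_comm_group, of "\<lambda>(p, q). p \<otimes>\<^bsub>R\<^esub> q" "Rr \<times> Rb"])
    show "(\<lambda>(p, q). p \<otimes>\<^bsub>R\<^esub> q) ` (Rr \<times> Rb) \<subseteq> carrier (add_monoid R)"
      using A(1) B(1) by auto
  qed (use that F_def in auto)
  interpret h: group_hom F "add_monoid R" h
    by (simp add: F.group_axioms a_group group_hom_axioms.intro group_hom.intro h)
  have hdiff: "h (a - b) = h a \<ominus>\<^bsub>R\<^esub> h b" if "a \<in> carrier F" "b \<in> carrier F" for a b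
  proof -
    have "h (a \<otimes>\<^bsub>F\<^esub> inv\<^bsub>F\<^esub> b) = h a \<otimes>\<^bsub>add_monoid R\<^esub> inv\<^bsub>add_monoid R\<^esub> h b"
      using that by simp
    then show ?thesis
      using that by (simp add: F_def a_minus_def a_inv_def)
  qed
  have frag_F: "frag_of (p, q) \<in> carrier F" if "p \<in> Rr" "q \<in> Rb" for p q
    using that by (simp add: F_def)
  have diff_F: "a - b \<in> carrier F" if "a \<in> carrier F" "b \<in> carrier F" for a b
    using that keys_diff[of a b] unfolding F_simps by blast
  have hrel: "h z = \<zero>\<^bsub>R\<^esub>" if z: "z \<in> tensor_relations R Rrb Rr Rb" for z
  proof -
    have c: "\<And>p. p \<in> Rr \<Longrightarrow> p \<in> carrier R" "\<And>q. q \<in> Rb \<Longrightarrow> q \<in> carrier R"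
      "\<And>s. s \<in> Rrb \<Longrightarrow> s \<in> carrier R" "\<And>s. s \<in> Rrb \<Longrightarrow> s \<in> Rr" "\<And>s. s \<in> Rrb \<Longrightarrow> s \<in> Rb"
      using A(1) B(1) S(1) assms(5,6) by auto
    have cancel: "a \<oplus>\<^bsub>R\<^esub> b \<oplus>\<^bsub>R\<^esub> \<ominus>\<^bsub>R\<^esub> a = b"
      if "a \<in> carrier R" "b \<in> carrier R" for a b
      using that by (metis a_assoc a_comm a_inv_closed r_neg r_zero)
    note simps = hdiff diff_F frag_F h_of A(6,7) B(6,7) c l_distr r_distr
    show ?thesis
      using z unfolding tensor_relations_def
    proof (elim UnE CollectE exE conjE)
      fix p p' q
      assume "z = frag_of (p \<oplus>\<^bsub>R\<^esub> p', q) - frag_of (p, q) - frag_of (p', q)"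
        and "p \<in> Rr" "p' \<in> Rr" "q \<in> Rb"
      moreover from this have "p \<otimes>\<^bsub>R\<^esub> q \<in> carrier R" "p' \<otimes>\<^bsub>R\<^esub> q \<in> carrier R"
        by (simp_all add: c)
      ultimately show ?thesis
        by (simp add: simps cancel a_minus_def r_neg)
    next
      fix p q q'
      assume "z = frag_of (p, q \<oplus>\<^bsub>R\<^esub> q') - frag_of (p, q) - frag_of (p, q')"
        and "p \<in> Rr" "q \<in> Rb" "q' \<in> Rb"
      moreover from this have "p \<otimes>\<^bsub>R\<^esub> q \<in> carrier R" "p \<otimes>\<^bsub>R\<^esub> q' \<in> carrier R"
        by (simp_all add: c)
      ultimately show ?thesis
        by (simp add: simps cancel a_minus_def r_neg)
    next
      fix p s q
      assume "z = frag_of (p \<otimes>\<^bsub>R\<^esub> s, q) - frag_of (p, s \<otimes>\<^bsub>R\<^esub> q)"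
        and "p \<in> Rr" "s \<in> Rrb" "q \<in> Rb"
      then show ?thesis
        by (simp add: simps m_assoc a_minus_def r_neg)
    qed
  qed
  have hK: "h z = \<zero>\<^bsub>R\<^esub>" if "z \<in> K" for z
  proof -
    have "tensor_relations R Rrb Rr Rb \<subseteq> kernel F (add_monoid R) h"
      using hrel rel_F by (auto simp: kernel_def)
    then have "K \<subseteq> kernel F (add_monoid R) h"
      using F.generate_subgroup_incl[OF _ h.subgroup_kernel]
      by (simp add: K_def tensor_kernel_def F_def)
    then show ?thesis
      using that by (auto simp: kernel_def)
  qed
  obtain g where g: "g \<in> hom (F Mod K) (add_monoid R)"
    and g_of: "\<And>z. z \<in> carrier F \<Longrightarrow> g (K #>\<^bsub>F\<^esub> z) = h z"
  proof (rule FactGroup_universal[OF h KN])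
    fix a b assume ab: "a \<in> carrier F" "b \<in> carrier F" "K #>\<^bsub>F\<^esub> a = K #>\<^bsub>F\<^esub> b"
    then have "a \<in> K #>\<^bsub>F\<^esub> b"
      using F.rcos_self[OF ab(1) K] by simp
    then obtain z where z: "z \<in> K" "a = z \<otimes>\<^bsub>F\<^esub> b"
      unfolding r_coset_def by auto
    then have "h a = h z \<oplus>\<^bsub>R\<^esub> h b"
      using h.hom_mult subgroup.mem_carrier[OF K] ab by simp
    then show "h a = h b"
      using hK[OF z(1)] h.hom_closed[OF ab(2)] by simp
  qed auto
  have "?P (restrict g (carrier ?T))"
  proof (intro conjI ballI)
    show "restrict g (carrier ?T) \<in> hom ?T (add_monoid R)"
      using g group.is_monoid[OF normal.factorgroup_is_group[OF KN]]
      unfolding T hom_def by (auto simp: monoid.m_closed simp del: mult_FactGroup)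
    show "restrict g (carrier ?T) (pure_tensor R Rrb Rr Rb p q) = p \<otimes>\<^bsub>R\<^esub> q"
      if "p \<in> Rr" "q \<in> Rb" for p q
      using that frag_F[OF that] g_of[OF frag_F[OF that]] h_of
      unfolding T pt by (auto simp: carrier_FactGroup)
  qed auto
  moreover have "h1 = h2" if h12: "?P h1" "?P h2" for h1 h2
  proof (rule extensionalityI)
    show "h1 \<in> extensional (carrier ?T)" "h2 \<in> extensional (carrier ?T)"
      using h12 by auto
    have GT: "group ?T"
      unfolding T by (rule normal.factorgroup_is_group[OF KN])
    interpret h1: group_hom ?T "add_monoid R" h1
      by (intro group_hom.intro group_hom_axioms.intro GT a_group) (use h12 in blast)
    interpret h2: group_hom ?T "add_monoid R" h2
      by (intro group_hom.intro group_hom_axioms.intro GT a_group) (use h12 in blast)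
    have pi: "(\<lambda>z. K #>\<^bsub>F\<^esub> z) \<in> hom F ?T"
      unfolding T by (rule normal.r_coset_hom_Mod[OF KN])
    interpret pi: group_hom F ?T "\<lambda>z. K #>\<^bsub>F\<^esub> z"
      by (intro group_hom.intro group_hom_axioms.intro F.group_axioms GT pi)
    fix t assume "t \<in> carrier ?T"
    then obtain z where z: "z \<in> carrier F" "t = K #>\<^bsub>F\<^esub> z"
      unfolding T by (auto simp: carrier_FactGroup)
    have "Poly_Mapping.keys z \<subseteq> Rr \<times> Rb"
      using z by (simp add: F_simps)
    then have "h1 (K #>\<^bsub>F\<^esub> z) = h2 (K #>\<^bsub>F\<^esub> z)"
    proof (induction rule: free_Abelian_group_induct[consumes 1, case_names zero diff gen])
      case zero
      have "(0 :: 'a \<times> 'a \<Rightarrow>\<^sub>0 int) = \<one>\<^bsub>F\<^esub>"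
        by (simp add: F_def)
      then show ?case
        using pi.hom_one h1.hom_one h2.hom_one by metis
    next
      case (diff a b)
      then have ab: "a \<in> carrier F" "b \<in> carrier F"
        by (simp_all add: F_simps)
      have "a - b = a \<otimes>\<^bsub>F\<^esub> inv\<^bsub>F\<^esub> b"
        using diff by (simp add: F_def)
      then show ?case
        using diff ab by (simp del: mult_FactGroup)
    next
      case (gen c)
      then obtain p q where "c = (p, q)" "p \<in> Rr" "q \<in> Rb"
        by auto
      then show ?case
        using h12 by (simp flip: pt)
    qed
    then show "h1 t = h2 t"
      using z by simp
  qed
  ultimately have "\<exists>!h. ?P h"
    by blast
  then have P: "?P (crossing_merge R Rrb Rr Rb)"
    unfolding crossing_merge_def by (rule theI')
  then show "crossing_merge R Rrb Rr Rb \<in> hom (tensor_product R Rrb Rr Rb) (add_monoid R)"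
    by blast
  fix p q assume "p \<in> Rr" "q \<in> Rb"
  then show "crossing_merge R Rrb Rr Rb (pure_tensor R Rrb Rr Rb p q) = p \<otimes>\<^bsub>R\<^esub> q"
    using P by blast
qed

definition bimodule_endomorphism ::
  "('a, 'm) ring_scheme \<Rightarrow> 'a set \<Rightarrow> 'a set \<Rightarrow> ('a \<Rightarrow> 'a) \<Rightarrow> bool" where
  "bimodule_endomorphism R A B \<phi> \<longleftrightarrow>
     \<phi> \<in> hom (add_monoid R) (add_monoid R) \<and>
     (\<forall>a\<in>A. \<forall>f\<in>carrier R. \<phi> (a \<otimes>\<^bsub>R\<^esub> f) = a \<otimes>\<^bsub>R\<^esub> \<phi> f) \<and>
     (\<forall>b\<in>B. \<forall>f\<in>carrier R. \<phi> (f \<otimes>\<^bsub>R\<^esub> b) = \<phi> f \<otimes>\<^bsub>R\<^esub> b)"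

end

theory Submission
  imports Defs
begin

text \<open>
  Let \<open>\<Phi>(f)\<close> be the sum of \<open>\<partial>\<^sub>r(f x\<^sub>\<alpha>) y\<^sub>\<alpha>\<close>. It is \<open>R\<^sup>r\<close>-linear because the trace is. Expanding
  \<open>b x\<^sub>\<alpha>\<close> in the basis \<open>x\<close> and collecting coefficients in the basis \<open>y\<close> moves any \<open>b \<in> R\<^sup>b\<close> past the
  coproduct, so \<open>\<Phi>\<close> is also \<open>R\<^sup>b\<close>-linear; allowing a second pair of dual bases in this computation
  gives independence of the choice. The elements \<open>g\<close> with \<open>\<Phi>(f g) = \<Phi>(f) g\<close> for all \<open>f\<close> form
  a subalgebra containing \<open>R\<^sup>r\<close> and \<open>R\<^sup>b\<close>, hence everything, and \<open>f = 1\<close> gives the claim.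
\<close>

section \<open>Finite sums and products under homomorphisms and linear maps\<close>

text \<open>Carries the product of pure tensors in \<open>crossing_split\<close>, taken in a
  multiplicatively written group, to a sum in \<open>R\<close>. For monoids \<open>hom\<close>
  demands only compatibility with the operation, so preservation of the unit is a separate
  hypothesis; it settles the empty product and also an infinite \<open>A\<close>, where
  \<open>finprod\<close> defaults to the unit.\<close>

lemma hom_finprod:
  assumes "comm_monoid G" "comm_monoid H" "h \<in> hom G H" "h \<one>\<^bsub>G\<^esub> = \<one>\<^bsub>H\<^esub>" "g \<in> A \<rightarrow> carrier G"
  shows "h (finprod G g A) = finprod H (\<lambda>i. h (g i)) A"
proof -
  interpret G: comm_monoid G by fact
  interpret H: comm_monoid H by fact
  show ?thesis
    using assms(5)
  proof (induction A rule: infinite_finite_induct)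
    case (insert i A)
    then have "g i \<in> carrier G" "g \<in> A \<rightarrow> carrier G" by auto
    moreover from this have "h (g i) \<in> carrier H" "(\<lambda>i. h (g i)) \<in> A \<rightarrow> carrier H"
      using hom_in_carrier[OF assms(3)] by auto
    ultimately show ?case
      using insert by (simp add: hom_mult[OF assms(3)])
  qed (simp_all add: assms(4))
qed

lemma (in abelian_monoid) finsum_swap:
  assumes "finite A" "finite B" "\<And>i j. i \<in> A \<Longrightarrow> j \<in> B \<Longrightarrow> g i j \<in> carrier G"
  shows "(\<Oplus>i\<in>A. \<Oplus>j\<in>B. g i j) = (\<Oplus>j\<in>B. \<Oplus>i\<in>A. g i j)"
  using assms(1,3)
proof (induction A rule: finite_induct)
  case empty
  show ?case by (simp add: finsum_zero)
next
  case (insert a A)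
  have "(\<Oplus>i\<in>insert a A. \<Oplus>j\<in>B. g i j) = (\<Oplus>j\<in>B. g a j) \<oplus> (\<Oplus>i\<in>A. \<Oplus>j\<in>B. g i j)"
    using insert by (intro finsum_insert) (auto intro!: finsum_closed)
  also have "\<dots> = (\<Oplus>j\<in>B. g a j \<oplus> (\<Oplus>i\<in>A. g i j))"
    using insert by (subst finsum_addf) (auto intro!: finsum_closed)
  also have "\<dots> = (\<Oplus>j\<in>B. \<Oplus>i\<in>insert a A. g i j)"
    using insert by (intro finsum_cong') (auto intro!: finsum_closed finsum_insert[symmetric])
  finally show ?case .
qed

lemma linear_over_finsum:
  assumes "cring R" "subring A R" "subring B R" "linear_over R A B \<phi>" "\<phi> \<in> B \<rightarrow> carrier R"
    and "finite I" "g \<in> I \<rightarrow> B"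
  shows "\<phi> (\<Oplus>\<^bsub>R\<^esub>i\<in>I. g i) = (\<Oplus>\<^bsub>R\<^esub>i\<in>I. \<phi> (g i))"
proof -
  interpret cring R by fact
  note A = subringE[OF assms(2)] and B = subringE[OF assms(3)]
  have add: "\<phi> (a \<oplus>\<^bsub>R\<^esub> b) = \<phi> a \<oplus>\<^bsub>R\<^esub> \<phi> b" if "a \<in> B" "b \<in> B" for a b
    using assms(4) that unfolding linear_over_def by blast
  \<comment> \<open>\<open>linear_over\<close> does not state that zero goes to zero; homogeneity
    for the scalar zero, an element of \<open>A\<close>, yields it.\<close>
  have "\<phi> (\<zero>\<^bsub>R\<^esub> \<otimes>\<^bsub>R\<^esub> \<zero>\<^bsub>R\<^esub>) = \<zero>\<^bsub>R\<^esub> \<otimes>\<^bsub>R\<^esub> \<phi> \<zero>\<^bsub>R\<^esub>"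
    using assms(4) A(2) B(2) unfolding linear_over_def by blast
  moreover have "\<phi> \<zero>\<^bsub>R\<^esub> \<in> carrier R"
    using assms(5) B(2) by blast
  ultimately have zero: "\<phi> \<zero>\<^bsub>R\<^esub> = \<zero>\<^bsub>R\<^esub>" by simp
  \<comment> \<open>Additivity of \<open>\<phi>\<close> is known only on \<open>B\<close>, so the
    induction also keeps the partial sums inside \<open>B\<close>.\<close>
  have "(\<Oplus>\<^bsub>R\<^esub>i\<in>I. g i) \<in> B \<and> \<phi> (\<Oplus>\<^bsub>R\<^esub>i\<in>I. g i) = (\<Oplus>\<^bsub>R\<^esub>i\<in>I. \<phi> (g i))"
    using assms(6,7)
  proof (induction I rule: finite_induct)
    case empty
    then show ?case by (simp add: zero B(2))
  next
    case (insert i I)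
    then have "g i \<in> B" "g \<in> I \<rightarrow> B" by auto
    moreover from this have "g i \<in> carrier R" "g \<in> I \<rightarrow> carrier R"
        "\<phi> (g i) \<in> carrier R" "(\<lambda>i. \<phi> (g i)) \<in> I \<rightarrow> carrier R"
      using B(1) assms(5) by auto
    ultimately show ?case
      using insert by (simp add: add B(7))
  qed
  then show ?thesis by blast
qed

section \<open>Dual bases and the coproduct of a Frobenius extension\<close>

lemma frobenius_extensionD:
  assumes "frobenius_extension k R A B tr"
  shows "subring A R" "subring B R" "A \<subseteq> B" "B \<subseteq> carrier R" "tr \<in> B \<rightarrow> A" "linear_over R A B tr"
    "tr \<in> B \<rightarrow> carrier R"
  using assms subringE(1)[of A R] subringE(1)[of B R]
  unfolding frobenius_extension_def ksubalgebra_def by auto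

text \<open>Commutativity turns one pairing condition into the other, the Kronecker delta being
  symmetric. Hence elements also expand in \<open>y\<close>, with coefficients read off against
  \<open>x\<close>.\<close>

lemma dual_bases_sym:
  assumes "cring R" "B \<subseteq> carrier R" "dual_bases R A B tr n x y"
  shows "dual_bases R A B tr n y x"
proof -
  interpret cring R by fact
  have "x \<alpha> \<otimes>\<^bsub>R\<^esub> y \<beta> = y \<beta> \<otimes>\<^bsub>R\<^esub> x \<alpha>" if "\<alpha> < n" "\<beta> < n" for \<alpha> \<beta>
    using assms(2,3) that unfolding dual_bases_def basis_over_def by (intro m_comm) auto
  then show ?thesis
    using assms(3) unfolding dual_bases_def by (metis (full_types))
qed

text \<open>Write \<open>z\<close> as a combination of the \<open>x \<alpha>\<close> with
  coefficients \<open>a \<alpha>\<close> in \<open>A\<close>. Multiplying by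
  \<open>y \<beta>\<close> and applying the \<open>A\<close>-linear trace kills every term except
  \<open>a \<beta>\<close>, so the coefficients must be these traces.\<close>

lemma dual_bases_expand:
  assumes "cring R" and frob: "frobenius_extension k R A B tr"
    and dual: "dual_bases R A B tr n x y" and z: "z \<in> B"
  shows "(\<Oplus>\<^bsub>R\<^esub>\<alpha>\<in>{..<n}. tr (z \<otimes>\<^bsub>R\<^esub> y \<alpha>) \<otimes>\<^bsub>R\<^esub> x \<alpha>) = z"
proof -
  interpret cring R by fact
  note F = frobenius_extensionD[OF frob]
  note B = subringE[OF F(2)]
  have x: "x \<alpha> \<in> B" and y: "y \<alpha> \<in> B" if "\<alpha> < n" for \<alpha>
    using dual that unfolding dual_bases_def basis_over_def by auto
  obtain a where a: "\<And>\<alpha>. \<alpha> < n \<Longrightarrow> a \<alpha> \<in> A"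
    and za: "z = (\<Oplus>\<^bsub>R\<^esub>\<alpha>\<in>{..<n}. a \<alpha> \<otimes>\<^bsub>R\<^esub> x \<alpha>)"
    using dual z unfolding dual_bases_def basis_over_def by (fastforce dest!: ex1_implies_ex)
  have carr: "\<And>b. b \<in> B \<Longrightarrow> b \<in> carrier R" "\<And>c. c \<in> A \<Longrightarrow> c \<in> B"
    using F(3,4) by auto
  have "tr (z \<otimes>\<^bsub>R\<^esub> y \<beta>) = a \<beta>" if \<beta>: "\<beta> < n" for \<beta>
  proof -
    have "z \<otimes>\<^bsub>R\<^esub> y \<beta> = (\<Oplus>\<^bsub>R\<^esub>\<alpha>\<in>{..<n}. a \<alpha> \<otimes>\<^bsub>R\<^esub> x \<alpha> \<otimes>\<^bsub>R\<^esub> y \<beta>)"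
      unfolding za using a x y \<beta> carr by (intro finsum_ldistr) auto
    also have "\<dots> = (\<Oplus>\<^bsub>R\<^esub>\<alpha>\<in>{..<n}. a \<alpha> \<otimes>\<^bsub>R\<^esub> (x \<alpha> \<otimes>\<^bsub>R\<^esub> y \<beta>))"
      using a x y \<beta> carr by (intro finsum_cong') (auto simp: m_assoc)
    finally have eq: "z \<otimes>\<^bsub>R\<^esub> y \<beta> = (\<Oplus>\<^bsub>R\<^esub>\<alpha>\<in>{..<n}. a \<alpha> \<otimes>\<^bsub>R\<^esub> (x \<alpha> \<otimes>\<^bsub>R\<^esub> y \<beta>))" .
    have "tr (z \<otimes>\<^bsub>R\<^esub> y \<beta>) = (\<Oplus>\<^bsub>R\<^esub>\<alpha>\<in>{..<n}. tr (a \<alpha> \<otimes>\<^bsub>R\<^esub> (x \<alpha> \<otimes>\<^bsub>R\<^esub> y \<beta>)))"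
      unfolding eq using a x y \<beta> carr B(6)
      by (intro linear_over_finsum[OF \<open>cring R\<close> F(1,2,6,7)]) auto
    \<comment> \<open>The test is oriented as \<open>\<beta> = \<alpha>\<close>, with the fixed
      index first, the form in which \<open>finsum_singleton\<close> collapses the sum.\<close>
    also have "\<dots> = (\<Oplus>\<^bsub>R\<^esub>\<alpha>\<in>{..<n}. if \<beta> = \<alpha> then a \<alpha> else \<zero>\<^bsub>R\<^esub>)"
    proof (intro finsum_cong' refl)
      fix \<alpha> assume "\<alpha> \<in> {..<n}"
      then have \<alpha>: "\<alpha> < n" by simp
      have "tr (a \<alpha> \<otimes>\<^bsub>R\<^esub> (x \<alpha> \<otimes>\<^bsub>R\<^esub> y \<beta>)) = a \<alpha> \<otimes>\<^bsub>R\<^esub> tr (x \<alpha> \<otimes>\<^bsub>R\<^esub> y \<beta>)"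
        using F(6) a[OF \<alpha>] B(6)[OF x[OF \<alpha>] y[OF \<beta>]] unfolding linear_over_def by blast
      moreover have "tr (x \<alpha> \<otimes>\<^bsub>R\<^esub> y \<beta>) = (if \<alpha> = \<beta> then \<one>\<^bsub>R\<^esub> else \<zero>\<^bsub>R\<^esub>)"
        using dual \<alpha> \<beta> unfolding dual_bases_def by blast
      ultimately show "tr (a \<alpha> \<otimes>\<^bsub>R\<^esub> (x \<alpha> \<otimes>\<^bsub>R\<^esub> y \<beta>)) = (if \<beta> = \<alpha> then a \<alpha> else \<zero>\<^bsub>R\<^esub>)"
        using a[OF \<alpha>] carr by auto
    qed (use a carr in auto)
    also have "\<dots> = a \<beta>"
      using a carr \<beta> by (intro finsum_singleton) auto
    finally show ?thesis .
  qed
  then show ?thesis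
    unfolding za using a x carr by (intro finsum_cong') auto
qed

text \<open>
  For \<open>b = 1\<close> this is independence of the dual bases, and for \<open>(u, v) = (x, y)\<close> it is
  linearity on the right.
\<close>

lemma trace_coproduct_mult:
  assumes "cring R" and frob: "frobenius_extension k R S B tr"
    and frob': "frobenius_extension k R A (carrier R) \<phi>" and "S \<subseteq> A"
    and xy: "dual_bases R S B tr n x y" and uv: "dual_bases R S B tr m u v"
    and f: "f \<in> carrier R" and b: "b \<in> B"
  shows "(\<Oplus>\<^bsub>R\<^esub>\<alpha>\<in>{..<m}. \<phi> (f \<otimes>\<^bsub>R\<^esub> b \<otimes>\<^bsub>R\<^esub> u \<alpha>) \<otimes>\<^bsub>R\<^esub> v \<alpha>) =
    (\<Oplus>\<^bsub>R\<^esub>\<beta>\<in>{..<n}. \<phi> (f \<otimes>\<^bsub>R\<^esub> x \<beta>) \<otimes>\<^bsub>R\<^esub> y \<beta>) \<otimes>\<^bsub>R\<^esub> b"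
proof -
  interpret cring R by fact
  note F = frobenius_extensionD[OF frob] and G = frobenius_extensionD[OF frob']
  have B: "c \<otimes>\<^bsub>R\<^esub> d \<in> B" if "c \<in> B" "d \<in> B" for c d
    using that by (rule subringE(6)[OF F(2)])
  have x: "x \<alpha> \<in> B" and y: "y \<alpha> \<in> B" if "\<alpha> < n" for \<alpha>
    using xy that unfolding dual_bases_def basis_over_def by auto
  have u: "u \<alpha> \<in> B" and v: "v \<alpha> \<in> B" if "\<alpha> < m" for \<alpha>
    using uv that unfolding dual_bases_def basis_over_def by auto
  have c: "b \<in> carrier R" "\<And>c. c \<in> B \<Longrightarrow> c \<in> carrier R" "\<And>c. c \<in> S \<Longrightarrow> c \<in> carrier R"
    "\<And>c. c \<in> A \<Longrightarrow> c \<in> carrier R"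
    using F(3,4) b G(3) by auto
  \<comment> \<open>One matrix plays two roles: \<open>t \<alpha> \<beta>\<close> is the coefficient
    of \<open>b \<otimes> u \<alpha>\<close> at \<open>x \<beta>\<close> and, after reordering the
    product under the trace, that of \<open>b \<otimes> y \<beta>\<close> at
    \<open>v \<alpha>\<close>.\<close>
  define t where "t \<alpha> \<beta> = tr (b \<otimes>\<^bsub>R\<^esub> u \<alpha> \<otimes>\<^bsub>R\<^esub> y \<beta>)" for \<alpha> \<beta>
  define p where "p \<beta> = \<phi> (f \<otimes>\<^bsub>R\<^esub> x \<beta>)" for \<beta>
  have t: "t \<alpha> \<beta> \<in> S" if "\<alpha> < m" "\<beta> < n" for \<alpha> \<beta>
    using F(5) B b u y that unfolding t_def by blast
  have tc: "t \<alpha> \<beta> \<in> carrier R" if "\<alpha> < m" "\<beta> < n" for \<alpha> \<beta>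
    using t c that by blast
  have p: "p \<beta> \<in> carrier R" if "\<beta> < n" for \<beta>
    using G(7) f x c that unfolding p_def by blast
  \<comment> \<open>First role of \<open>t\<close>: expand in the basis \<open>x\<close>. The
    coefficients lie in \<open>S\<close>, hence in \<open>A\<close>, so they come out of the
    \<open>A\<close>-linear map \<open>\<phi>\<close>.\<close>
  have "\<phi> (f \<otimes>\<^bsub>R\<^esub> b \<otimes>\<^bsub>R\<^esub> u \<alpha>) = (\<Oplus>\<^bsub>R\<^esub>\<beta>\<in>{..<n}. t \<alpha> \<beta> \<otimes>\<^bsub>R\<^esub> p \<beta>)" if \<alpha>: "\<alpha> < m" for \<alpha>
  proof -
    have "b \<otimes>\<^bsub>R\<^esub> u \<alpha> = (\<Oplus>\<^bsub>R\<^esub>\<beta>\<in>{..<n}. t \<alpha> \<beta> \<otimes>\<^bsub>R\<^esub> x \<beta>)"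
      unfolding t_def using dual_bases_expand[OF \<open>cring R\<close> frob xy] B b u[OF \<alpha>] by simp
    then have "f \<otimes>\<^bsub>R\<^esub> b \<otimes>\<^bsub>R\<^esub> u \<alpha> = f \<otimes>\<^bsub>R\<^esub> (\<Oplus>\<^bsub>R\<^esub>\<beta>\<in>{..<n}. t \<alpha> \<beta> \<otimes>\<^bsub>R\<^esub> x \<beta>)"
      using f c u[OF \<alpha>] by (simp add: m_assoc)
    also have "\<dots> = (\<Oplus>\<^bsub>R\<^esub>\<beta>\<in>{..<n}. f \<otimes>\<^bsub>R\<^esub> (t \<alpha> \<beta> \<otimes>\<^bsub>R\<^esub> x \<beta>))"
      using f tc[OF \<alpha>] x c by (intro finsum_rdistr) auto
    also have "\<dots> = (\<Oplus>\<^bsub>R\<^esub>\<beta>\<in>{..<n}. t \<alpha> \<beta> \<otimes>\<^bsub>R\<^esub> (f \<otimes>\<^bsub>R\<^esub> x \<beta>))"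
      using f tc[OF \<alpha>] x c by (intro finsum_cong') (auto simp: m_lcomm)
    finally have eq: "f \<otimes>\<^bsub>R\<^esub> b \<otimes>\<^bsub>R\<^esub> u \<alpha> = (\<Oplus>\<^bsub>R\<^esub>\<beta>\<in>{..<n}. t \<alpha> \<beta> \<otimes>\<^bsub>R\<^esub> (f \<otimes>\<^bsub>R\<^esub> x \<beta>))" .
    have "\<phi> (f \<otimes>\<^bsub>R\<^esub> b \<otimes>\<^bsub>R\<^esub> u \<alpha>) = (\<Oplus>\<^bsub>R\<^esub>\<beta>\<in>{..<n}. \<phi> (t \<alpha> \<beta> \<otimes>\<^bsub>R\<^esub> (f \<otimes>\<^bsub>R\<^esub> x \<beta>)))"
      unfolding eq using f tc[OF \<alpha>] x c
      by (intro linear_over_finsum[OF \<open>cring R\<close> G(1,2,6,7)]) auto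
    also have "\<dots> = (\<Oplus>\<^bsub>R\<^esub>\<beta>\<in>{..<n}. t \<alpha> \<beta> \<otimes>\<^bsub>R\<^esub> p \<beta>)"
    proof (intro finsum_cong' refl)
      fix \<beta> assume "\<beta> \<in> {..<n}"
      then have "t \<alpha> \<beta> \<in> A" "f \<otimes>\<^bsub>R\<^esub> x \<beta> \<in> carrier R"
        using t[OF \<alpha>] \<open>S \<subseteq> A\<close> f x c by auto
      then show "\<phi> (t \<alpha> \<beta> \<otimes>\<^bsub>R\<^esub> (f \<otimes>\<^bsub>R\<^esub> x \<beta>)) = t \<alpha> \<beta> \<otimes>\<^bsub>R\<^esub> p \<beta>"
        using G(6) unfolding linear_over_def p_def by blast
    qed (use tc[OF \<alpha>] p in auto)
    finally show ?thesis .
  qed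
  then have "(\<Oplus>\<^bsub>R\<^esub>\<alpha>\<in>{..<m}. \<phi> (f \<otimes>\<^bsub>R\<^esub> b \<otimes>\<^bsub>R\<^esub> u \<alpha>) \<otimes>\<^bsub>R\<^esub> v \<alpha>) =
      (\<Oplus>\<^bsub>R\<^esub>\<alpha>\<in>{..<m}. \<Oplus>\<^bsub>R\<^esub>\<beta>\<in>{..<n}. t \<alpha> \<beta> \<otimes>\<^bsub>R\<^esub> p \<beta> \<otimes>\<^bsub>R\<^esub> v \<alpha>)"
    using tc p v c by (intro finsum_cong') (auto intro!: finsum_closed finsum_ldistr)
  also have "\<dots> = (\<Oplus>\<^bsub>R\<^esub>\<beta>\<in>{..<n}. \<Oplus>\<^bsub>R\<^esub>\<alpha>\<in>{..<m}. t \<alpha> \<beta> \<otimes>\<^bsub>R\<^esub> p \<beta> \<otimes>\<^bsub>R\<^esub> v \<alpha>)"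
    using tc p v c by (intro finsum_swap) auto
  also have "\<dots> = (\<Oplus>\<^bsub>R\<^esub>\<beta>\<in>{..<n}. p \<beta> \<otimes>\<^bsub>R\<^esub> y \<beta> \<otimes>\<^bsub>R\<^esub> b)"
  proof (intro finsum_cong' refl)
    fix \<beta> assume "\<beta> \<in> {..<n}"
    then have \<beta>: "\<beta> < n" by simp
    have "(\<Oplus>\<^bsub>R\<^esub>\<alpha>\<in>{..<m}. t \<alpha> \<beta> \<otimes>\<^bsub>R\<^esub> p \<beta> \<otimes>\<^bsub>R\<^esub> v \<alpha>) = (\<Oplus>\<^bsub>R\<^esub>\<alpha>\<in>{..<m}. p \<beta> \<otimes>\<^bsub>R\<^esub> (t \<alpha> \<beta> \<otimes>\<^bsub>R\<^esub> v \<alpha>))"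
      using tc[OF _ \<beta>] p[OF \<beta>] v c by (intro finsum_cong') (auto simp: m_ac)
    also have "\<dots> = p \<beta> \<otimes>\<^bsub>R\<^esub> (\<Oplus>\<^bsub>R\<^esub>\<alpha>\<in>{..<m}. t \<alpha> \<beta> \<otimes>\<^bsub>R\<^esub> v \<alpha>)"
      using tc[OF _ \<beta>] p[OF \<beta>] v c by (intro finsum_rdistr[symmetric]) auto
    \<comment> \<open>Second role of \<open>t\<close>: with the sums interchanged, the inner one is
      the expansion of \<open>b \<otimes> y \<beta>\<close> in the basis \<open>v\<close>, whose
      coefficients are traces against \<open>u\<close>; this is why the dual pair is swapped
      below.\<close>
    also have "(\<Oplus>\<^bsub>R\<^esub>\<alpha>\<in>{..<m}. t \<alpha> \<beta> \<otimes>\<^bsub>R\<^esub> v \<alpha>) =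
        (\<Oplus>\<^bsub>R\<^esub>\<alpha>\<in>{..<m}. tr (b \<otimes>\<^bsub>R\<^esub> y \<beta> \<otimes>\<^bsub>R\<^esub> u \<alpha>) \<otimes>\<^bsub>R\<^esub> v \<alpha>)"
    proof -
      have "t \<alpha> \<beta> = tr (b \<otimes>\<^bsub>R\<^esub> y \<beta> \<otimes>\<^bsub>R\<^esub> u \<alpha>)" if "\<alpha> < m" for \<alpha>
        unfolding t_def using u[OF that] y[OF \<beta>] c by (simp add: m_ac)
      then show ?thesis
        using tc[OF _ \<beta>] v c by (intro finsum_cong') auto
    qed
    also have "\<dots> = b \<otimes>\<^bsub>R\<^esub> y \<beta>"
      using dual_bases_expand[OF \<open>cring R\<close> frob dual_bases_sym[OF \<open>cring R\<close> F(4) uv]]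
        B b y[OF \<beta>] by simp
    finally show "(\<Oplus>\<^bsub>R\<^esub>\<alpha>\<in>{..<m}. t \<alpha> \<beta> \<otimes>\<^bsub>R\<^esub> p \<beta> \<otimes>\<^bsub>R\<^esub> v \<alpha>) = p \<beta> \<otimes>\<^bsub>R\<^esub> y \<beta> \<otimes>\<^bsub>R\<^esub> b"
      using p[OF \<beta>] y[OF \<beta>] c by (simp add: m_ac)
  qed (use p y c in auto)
  also have "\<dots> = (\<Oplus>\<^bsub>R\<^esub>\<beta>\<in>{..<n}. p \<beta> \<otimes>\<^bsub>R\<^esub> y \<beta>) \<otimes>\<^bsub>R\<^esub> b"
    using p y c by (intro finsum_ldistr[symmetric]) auto
  finally show ?thesis unfolding p_def .
qed

section \<open>The subalgebra of elements over which an additive map is linear\<close>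

text \<open>Sums are handled by additivity of \<open>\<Phi>\<close>, and products by moving one
  factor out after the other. The given subalgebra \<open>A\<close> provides the rest: it contains
  one, minus one and all scalar multiples of one, so negation and scalar multiplication become
  products with elements of \<open>A\<close>. No scalar linearity of \<open>\<Phi>\<close> has to be
  assumed.\<close>

lemma linear_subalgebra:
  assumes "algebra k R" "ksubalgebra k R A"
    and closed: "\<And>f. f \<in> carrier R \<Longrightarrow> \<Phi> f \<in> carrier R"
    and add: "\<And>f g. f \<in> carrier R \<Longrightarrow> g \<in> carrier R \<Longrightarrow> \<Phi> (f \<oplus>\<^bsub>R\<^esub> g) = \<Phi> f \<oplus>\<^bsub>R\<^esub> \<Phi> g"
    and A: "\<And>f a. f \<in> carrier R \<Longrightarrow> a \<in> A \<Longrightarrow> \<Phi> (f \<otimes>\<^bsub>R\<^esub> a) = \<Phi> f \<otimes>\<^bsub>R\<^esub> a"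
  shows "ksubalgebra k R {g \<in> carrier R. \<forall>f\<in>carrier R. \<Phi> (f \<otimes>\<^bsub>R\<^esub> g) = \<Phi> f \<otimes>\<^bsub>R\<^esub> g}"
    (is "ksubalgebra k R ?C")
proof -
  interpret M: cring R by (rule algebra.axioms(2)[OF assms(1)])
  interpret algebra k R by fact
  have sub: "subring A R" and smult: "\<And>c a. c \<in> carrier k \<Longrightarrow> a \<in> A \<Longrightarrow> c \<odot>\<^bsub>R\<^esub> a \<in> A"
    using assms(2) unfolding ksubalgebra_def by auto
  note AE = subringE[OF sub]
  have A_C: "A \<subseteq> ?C"
    using AE(1) A by auto
  have mult: "g \<otimes>\<^bsub>R\<^esub> h \<in> ?C" if "g \<in> ?C" "h \<in> ?C" for g h
    using that closed by (auto simp flip: M.m_assoc)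
  have neg: "\<ominus>\<^bsub>R\<^esub> g \<in> ?C" if "g \<in> ?C" for g
  proof -
    have "\<ominus>\<^bsub>R\<^esub> \<one>\<^bsub>R\<^esub> \<otimes>\<^bsub>R\<^esub> g = \<ominus>\<^bsub>R\<^esub> g"
      using that M.l_minus by simp
    then show ?thesis
      using mult[of "\<ominus>\<^bsub>R\<^esub> \<one>\<^bsub>R\<^esub>" g] that AE(3,5) A_C by (metis (lifting) subsetD)
  qed
  have "subring ?C R"
  proof (rule M.subringI)
    show "g \<oplus>\<^bsub>R\<^esub> h \<in> ?C" if "g \<in> ?C" "h \<in> ?C" for g h
      using that closed by (auto simp: M.r_distr add)
  qed (use AE(3) A_C mult neg in auto)
  moreover have "c \<odot>\<^bsub>R\<^esub> g \<in> ?C" if "c \<in> carrier k" "g \<in> ?C" for c g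
  proof -
    have "c \<odot>\<^bsub>R\<^esub> \<one>\<^bsub>R\<^esub> \<otimes>\<^bsub>R\<^esub> g = c \<odot>\<^bsub>R\<^esub> g"
      using that by (simp add: smult_assoc2)
    then show ?thesis
      using mult[of "c \<odot>\<^bsub>R\<^esub> \<one>\<^bsub>R\<^esub>" g] that smult[OF _ AE(3)] A_C by (metis (lifting) subsetD)
  qed
  ultimately show ?thesis
    unfolding ksubalgebra_def by blast
qed

section \<open>The tensor product and the composite of the two crossings\<close>

text \<open>Ensures that \<open>generate\<close> produces a subgroup in
  \<open>tensor_kernel\<close>. The inclusions of \<open>S\<close> in \<open>A\<close> and in
  \<open>B\<close> keep both sides of the balancing relation supported on
  \<open>A \<times> B\<close>.\<close>

lemma tensor_relations_subset:
  assumes "subring A R" "subring B R" "S \<subseteq> A" "S \<subseteq> B"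
  shows "tensor_relations R S A B \<subseteq> carrier (free_Abelian_group (A \<times> B))"
proof -
  note A = subringE(6,7)[OF assms(1)] and B = subringE(6,7)[OF assms(2)]
  have gen: "Poly_Mapping.keys (frag_of z) \<subseteq> A \<times> B" if "z \<in> A \<times> B" for z :: "'a \<times> 'a"
    using that by simp
  have diff: "Poly_Mapping.keys (a - b) \<subseteq> A \<times> B"
    if "Poly_Mapping.keys a \<subseteq> A \<times> B" "Poly_Mapping.keys b \<subseteq> A \<times> B"
    for a b :: "'a \<times> 'a \<Rightarrow>\<^sub>0 int"
    using that keys_diff[of a b] by blast
  have carrier: "carrier (free_Abelian_group (A \<times> B)) = {c. Poly_Mapping.keys c \<subseteq> A \<times> B}"
    by auto
  have mult: "p \<otimes>\<^bsub>R\<^esub> s \<in> A" "s \<otimes>\<^bsub>R\<^esub> q \<in> B" if "p \<in> A" "s \<in> S" "q \<in> B" for p s q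
    using that A(1) B(1) assms(3,4) by blast+
  show ?thesis
    unfolding tensor_relations_def carrier
    by (rule subsetI, rule CollectI, elim UnE CollectE exE conjE; hypsubst;
        intro diff gen; simp add: A B mult)
qed

text \<open>A quotient of a free Abelian group by a subgroup is Abelian. Commutativity gives the
  indexed product in \<open>crossing_split\<close> its expected meaning.\<close>

lemma comm_group_tensor_product:
  assumes "subring A R" "subring B R" "S \<subseteq> A" "S \<subseteq> B"
  shows "comm_group (tensor_product R S A B)"
    and "\<And>p q. p \<in> A \<Longrightarrow> q \<in> B \<Longrightarrow> pure_tensor R S A B p q \<in> carrier (tensor_product R S A B)"
proof -
  interpret F: comm_group "free_Abelian_group (A \<times> B)"
    by (rule abelian_free_Abelian_group)
  have "subgroup (tensor_kernel R S A B) (free_Abelian_group (A \<times> B))"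
    unfolding tensor_kernel_def
    using F.generate_is_subgroup tensor_relations_subset[OF assms] by blast
  then show "comm_group (tensor_product R S A B)"
    unfolding tensor_product_def by (rule F.abelian_FactGroup)
  show "pure_tensor R S A B p q \<in> carrier (tensor_product R S A B)" if "p \<in> A" "q \<in> B" for p q
    using that unfolding tensor_product_def pure_tensor_def carrier_FactGroup by auto
qed

text \<open>The merging map is a homomorphism to the additive group of \<open>R\<close>, so it can
  be applied factor by factor, and each pure tensor goes to the product of its entries. The
  membership hypotheses make every factor a genuine pure tensor of \<open>A\<close> and
  \<open>B\<close>.\<close>

lemma crossing_merge_split:
  assumes "cring R" and subs: "subring S R" "subring A R" "subring B R" "S \<subseteq> A" "S \<subseteq> B"
    and mem: "\<And>\<alpha>. \<alpha> < n \<Longrightarrow> \<phi> (f \<otimes>\<^bsub>R\<^esub> x \<alpha>) \<in> A" "\<And>\<alpha>. \<alpha> < n \<Longrightarrow> y \<alpha> \<in> B"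
  shows "crossing_merge R S A B (crossing_split R S A B \<phi> n x y f) =
    (\<Oplus>\<^bsub>R\<^esub>\<alpha>\<in>{..<n}. \<phi> (f \<otimes>\<^bsub>R\<^esub> x \<alpha>) \<otimes>\<^bsub>R\<^esub> y \<alpha>)"
proof -
  interpret cring R by fact
  let ?T = "tensor_product R S A B" and ?h = "crossing_merge R S A B"
  note T = comm_group_tensor_product[OF subs(2-5)]
  note h = crossing_merge[OF assms(1-6)]
  interpret T: comm_group ?T by (rule T)
  \<comment> \<open>Between groups a homomorphism preserves the unit, which is the extra hypothesis
    of \<open>hom_finprod\<close>.\<close>
  interpret h: group_hom ?T "add_monoid R" ?h
    by (intro group_hom.intro group_hom_axioms.intro T.group_axioms a_group h)
  have "?h (crossing_split R S A B \<phi> n x y f) =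
      finprod (add_monoid R) (\<lambda>\<alpha>. ?h (pure_tensor R S A B (\<phi> (f \<otimes>\<^bsub>R\<^esub> x \<alpha>)) (y \<alpha>))) {..<n}"
    unfolding crossing_split_def using h.hom_one mem
    by (intro hom_finprod h(1) T.comm_monoid_axioms a_comm_monoid) (auto intro: T(2))
  also have "\<dots> = (\<Oplus>\<^bsub>R\<^esub>\<alpha>\<in>{..<n}. \<phi> (f \<otimes>\<^bsub>R\<^esub> x \<alpha>) \<otimes>\<^bsub>R\<^esub> y \<alpha>)"
    using mem subringE(1)[OF subs(2)] subringE(1)[OF subs(3)]
    unfolding finsum_def[symmetric] by (intro finsum_cong') (auto simp: h(2) subset_iff)
  finally show ?thesis .
qed

section \<open>The composite of the crossings as multiplication by one element\<close>

theorem mainTheorem2: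
  fixes k :: "('k, 'l) ring_scheme"
    and R :: "('k, 'a, 'm) module_scheme"
    and Rr Rb Rrb :: "'a set"
    and tr_r tr_b tr_r_rb tr_b_rb :: "'a \<Rightarrow> 'a"
    and n m :: nat
    and x y u v :: "nat \<Rightarrow> 'a"
  assumes "compatible_frobenius_square k R Rr Rb Rrb tr_r tr_b tr_r_rb tr_b_rb"
    and "algebra_generated k R (Rr \<union> Rb) = carrier R"
    and "dual_bases R Rrb Rb tr_b_rb n x y"
    and "dual_bases R Rrb Rb tr_b_rb m u v"
  shows
    "bimodule_endomorphism R Rr Rb
       (crossing_merge R Rrb Rr Rb \<circ> crossing_split R Rrb Rr Rb tr_r n x y) \<and>
     (\<forall>f\<in>carrier R.
        (crossing_merge R Rrb Rr Rb \<circ> crossing_split R Rrb Rr Rb tr_r n x y) f =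
          f \<otimes>\<^bsub>R\<^esub> (\<Oplus>\<^bsub>R\<^esub>\<alpha>\<in>{..<m}. tr_r (u \<alpha>) \<otimes>\<^bsub>R\<^esub> v \<alpha>)) \<and>
     (\<forall>f\<in>carrier R.
        (\<Oplus>\<^bsub>R\<^esub>\<alpha>\<in>{..<n}. tr_r (f \<otimes>\<^bsub>R\<^esub> x \<alpha>) \<otimes>\<^bsub>R\<^esub> y \<alpha>) =
          f \<otimes>\<^bsub>R\<^esub> (\<Oplus>\<^bsub>R\<^esub>\<alpha>\<in>{..<m}. tr_r (u \<alpha>) \<otimes>\<^bsub>R\<^esub> v \<alpha>))"
proof -
  have "algebra k R"
    using assms(1) unfolding compatible_frobenius_square_def by blast
  then have cr: "cring R" by (rule algebra.axioms(2))
  interpret M: cring R by (fact cr)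
  interpret compatible_frobenius_square k R Rr Rb Rrb tr_r tr_b tr_r_rb tr_b_rb by fact
  note fr = frobenius_extensionD[OF frob_r] and fb = frobenius_extensionD[OF frob_b_rb]
    and frb = frobenius_extensionD[OF frob_r_rb]
  have x: "x \<alpha> \<in> Rb" "x \<alpha> \<in> carrier R" and y: "y \<alpha> \<in> Rb" "y \<alpha> \<in> carrier R" if "\<alpha> < n" for \<alpha>
    using assms(3) fb(4) that unfolding dual_bases_def basis_over_def by auto
  have u: "u \<alpha> \<in> carrier R" and v: "v \<alpha> \<in> carrier R" if "\<alpha> < m" for \<alpha>
    using assms(4) fb(4) that unfolding dual_bases_def basis_over_def by auto
  have tr: "tr_r f \<in> carrier R" if "f \<in> carrier R" for f
    using fr(7) that by blast
  \<comment> \<open>\<open>\<Phi>\<close> is the explicit formula for the composite in the pair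
    \<open>x\<close>, \<open>y\<close>; \<open>e\<close> will be its value at one, computed in the
    possibly different pair \<open>u\<close>, \<open>v\<close>.\<close>
  define \<Phi> where "\<Phi> f = (\<Oplus>\<^bsub>R\<^esub>\<alpha>\<in>{..<n}. tr_r (f \<otimes>\<^bsub>R\<^esub> x \<alpha>) \<otimes>\<^bsub>R\<^esub> y \<alpha>)" for f
  define e where "e = (\<Oplus>\<^bsub>R\<^esub>\<alpha>\<in>{..<m}. tr_r (u \<alpha>) \<otimes>\<^bsub>R\<^esub> v \<alpha>)"
  have e: "e \<in> carrier R"
    unfolding e_def using tr u v by (auto intro!: M.finsum_closed)
  have closed: "\<Phi> f \<in> carrier R" if "f \<in> carrier R" for f
    unfolding \<Phi>_def using tr x y that by (auto intro!: M.finsum_closed)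
  have add: "\<Phi> (f \<oplus>\<^bsub>R\<^esub> g) = \<Phi> f \<oplus>\<^bsub>R\<^esub> \<Phi> g" if fg: "f \<in> carrier R" "g \<in> carrier R" for f g
  proof -
    have "tr_r ((f \<oplus>\<^bsub>R\<^esub> g) \<otimes>\<^bsub>R\<^esub> x \<alpha>) = tr_r (f \<otimes>\<^bsub>R\<^esub> x \<alpha>) \<oplus>\<^bsub>R\<^esub> tr_r (g \<otimes>\<^bsub>R\<^esub> x \<alpha>)" if "\<alpha> < n" for \<alpha>
      using fr(6) x(2)[OF that] fg unfolding linear_over_def by (simp add: M.l_distr)
    then have "\<Phi> (f \<oplus>\<^bsub>R\<^esub> g) = (\<Oplus>\<^bsub>R\<^esub>\<alpha>\<in>{..<n}.
        tr_r (f \<otimes>\<^bsub>R\<^esub> x \<alpha>) \<otimes>\<^bsub>R\<^esub> y \<alpha> \<oplus>\<^bsub>R\<^esub> tr_r (g \<otimes>\<^bsub>R\<^esub> x \<alpha>) \<otimes>\<^bsub>R\<^esub> y \<alpha>)"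
      unfolding \<Phi>_def using tr x y fg by (intro M.finsum_cong') (auto simp: M.l_distr)
    also have "\<dots> = \<Phi> f \<oplus>\<^bsub>R\<^esub> \<Phi> g"
      unfolding \<Phi>_def using tr x y fg by (intro M.finsum_addf) auto
    finally show ?thesis .
  qed
  \<comment> \<open>The left action of \<open>Rr\<close> is written on the right, which
    commutativity permits, so that both actions have the shape of the condition defining
    \<open>?C\<close>.\<close>
  have left: "\<Phi> (f \<otimes>\<^bsub>R\<^esub> a) = \<Phi> f \<otimes>\<^bsub>R\<^esub> a" if f: "f \<in> carrier R" and a: "a \<in> Rr" for f a
  proof -
    have ac: "a \<in> carrier R" using fr(3) a by blast
    have "tr_r (f \<otimes>\<^bsub>R\<^esub> a \<otimes>\<^bsub>R\<^esub> x \<alpha>) \<otimes>\<^bsub>R\<^esub> y \<alpha> = tr_r (f \<otimes>\<^bsub>R\<^esub> x \<alpha>) \<otimes>\<^bsub>R\<^esub> y \<alpha> \<otimes>\<^bsub>R\<^esub> a" if \<alpha>: "\<alpha> < n" for \<alpha>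
    proof -
      have fx: "f \<otimes>\<^bsub>R\<^esub> x \<alpha> \<in> carrier R" using f x(2)[OF \<alpha>] by simp
      have "f \<otimes>\<^bsub>R\<^esub> a \<otimes>\<^bsub>R\<^esub> x \<alpha> = a \<otimes>\<^bsub>R\<^esub> (f \<otimes>\<^bsub>R\<^esub> x \<alpha>)"
        using f ac x(2)[OF \<alpha>] by (simp add: M.m_ac)
      moreover have "tr_r (a \<otimes>\<^bsub>R\<^esub> (f \<otimes>\<^bsub>R\<^esub> x \<alpha>)) = a \<otimes>\<^bsub>R\<^esub> tr_r (f \<otimes>\<^bsub>R\<^esub> x \<alpha>)"
        using fr(6) fx a unfolding linear_over_def by blast
      ultimately show ?thesis
        using tr[OF fx] y(2)[OF \<alpha>] ac by (simp add: M.m_ac)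
    qed
    then have "\<Phi> (f \<otimes>\<^bsub>R\<^esub> a) = (\<Oplus>\<^bsub>R\<^esub>\<alpha>\<in>{..<n}. tr_r (f \<otimes>\<^bsub>R\<^esub> x \<alpha>) \<otimes>\<^bsub>R\<^esub> y \<alpha> \<otimes>\<^bsub>R\<^esub> a)"
      unfolding \<Phi>_def using tr x y f ac by (intro M.finsum_cong') auto
    also have "\<dots> = \<Phi> f \<otimes>\<^bsub>R\<^esub> a"
      unfolding \<Phi>_def using tr x y f ac by (intro M.finsum_ldistr[symmetric]) auto
    finally show ?thesis .
  qed
  have right: "\<Phi> (f \<otimes>\<^bsub>R\<^esub> b) = \<Phi> f \<otimes>\<^bsub>R\<^esub> b" if "f \<in> carrier R" "b \<in> Rb" for f b
    unfolding \<Phi>_def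
    using trace_coproduct_mult[OF cr frob_b_rb frob_r frb(3) assms(3) assms(3) that] .
  let ?C = "{g \<in> carrier R. \<forall>f\<in>carrier R. \<Phi> (f \<otimes>\<^bsub>R\<^esub> g) = \<Phi> f \<otimes>\<^bsub>R\<^esub> g}"
  have "ksubalgebra k R Rr"
    using frob_r unfolding frobenius_extension_def by blast
  \<comment> \<open>\<open>Rr\<close> serves as the subalgebra that \<open>linear_subalgebra\<close>
    starts from.\<close>
  then have "ksubalgebra k R ?C"
    using algebra_axioms closed add left by (intro linear_subalgebra) auto
  moreover have "Rr \<union> Rb \<subseteq> ?C"
    using fr(3) fb(4) left right by auto
  \<comment> \<open>The generation hypothesis enters here: \<open>carrier R\<close> is the hull of
    \<open>Rr \<union> Rb\<close>, which is contained in every subalgebra containing that union, in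
    particular in \<open>?C\<close>.\<close>
  ultimately have "carrier R \<subseteq> ?C"
    unfolding assms(2)[symmetric] algebra_generated_def by (intro hull_minimal)
  then have all: "\<Phi> (f \<otimes>\<^bsub>R\<^esub> g) = \<Phi> f \<otimes>\<^bsub>R\<^esub> g" if "f \<in> carrier R" "g \<in> carrier R" for f g
    using that by blast
  have "\<one>\<^bsub>R\<^esub> \<in> Rb" by (rule subringE(3)[OF fb(2)])
  \<comment> \<open>With both \<open>f\<close> and \<open>b\<close> equal to one, this only
    exchanges the pair \<open>u\<close>, \<open>v\<close> for \<open>x\<close>, \<open>y\<close>,
    and so identifies \<open>\<Phi>\<close> at one with \<open>e\<close>.\<close>
  with trace_coproduct_mult[OF cr frob_b_rb frob_r frb(3) assms(3,4) M.one_closed]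
  have "(\<Oplus>\<^bsub>R\<^esub>\<alpha>\<in>{..<m}. tr_r (\<one>\<^bsub>R\<^esub> \<otimes>\<^bsub>R\<^esub> \<one>\<^bsub>R\<^esub> \<otimes>\<^bsub>R\<^esub> u \<alpha>) \<otimes>\<^bsub>R\<^esub> v \<alpha>) = \<Phi> \<one>\<^bsub>R\<^esub> \<otimes>\<^bsub>R\<^esub> \<one>\<^bsub>R\<^esub>"
    unfolding \<Phi>_def .
  moreover have "(\<Oplus>\<^bsub>R\<^esub>\<alpha>\<in>{..<m}. tr_r (\<one>\<^bsub>R\<^esub> \<otimes>\<^bsub>R\<^esub> \<one>\<^bsub>R\<^esub> \<otimes>\<^bsub>R\<^esub> u \<alpha>) \<otimes>\<^bsub>R\<^esub> v \<alpha>) = e"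
    unfolding e_def using tr u v by (intro M.finsum_cong') auto
  ultimately have "\<Phi> \<one>\<^bsub>R\<^esub> = e"
    using closed by simp
  then have \<Phi>: "\<Phi> f = f \<otimes>\<^bsub>R\<^esub> e" if "f \<in> carrier R" for f
    using all[OF M.one_closed that] that e by (simp add: M.m_comm)
  have "(crossing_merge R Rrb Rr Rb \<circ> crossing_split R Rrb Rr Rb tr_r n x y) f = \<Phi> f"
    if "f \<in> carrier R" for f
    unfolding \<Phi>_def comp_def using that x y fr(5)
    by (intro crossing_merge_split cr fb(1,2,3) fr(1) frb(3)) auto
  with \<Phi> have comp:
    "(crossing_merge R Rrb Rr Rb \<circ> crossing_split R Rrb Rr Rb tr_r n x y) f = f \<otimes>\<^bsub>R\<^esub> e"
    if "f \<in> carrier R" for f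
    using that by simp
  \<comment> \<open>Multiplication by \<open>e\<close> is additive and, \<open>R\<close> being
    commutative, respects both actions; the composite stays folded so that \<open>comp\<close> can
    replace it by this multiplication.\<close>
  have "bimodule_endomorphism R Rr Rb
      (crossing_merge R Rrb Rr Rb \<circ> crossing_split R Rrb Rr Rb tr_r n x y)"
  proof -
    have "a \<in> carrier R" if "a \<in> Rr \<union> Rb" for a
      using fr(3) fb(4) that by blast
    then show ?thesis
      unfolding bimodule_endomorphism_def hom_def using e
      by (auto simp: comp M.l_distr M.r_distr M.m_ac simp del: comp_apply)
  qed
  then show ?thesis
    using comp \<Phi> unfolding \<Phi>_def e_def by blast
qed

end
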